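(* Let $X$ be a random variable with support $(0,+\infty)$, with cdf $F$ and with pdf $f$ that is differentiable and strictly positive on $(0,+\infty)$. Then $X$ is exponentially distributed (i.e. there is $\lambda>0$ with $f(x)=\lambda e^{-\lambda x}$ for all $x>0$) if and only if, for all $(t_1,t_2)$ such that $0<t_1<t_2<+\infty$, $$IJ(t_1,t_2)=-\frac14\left[h_1(t_1,t_2)+h_2(t_1,t_2)\right].$$
   Context: For $0<t_1<t_2<+\infty$ with $F(t_1)<F(t_2)$: - the interval extropy of $X$ is $IJ(t_1,t_2)=-\frac{1}{2(F(t_2)-F(t_1))^2}\int_{t_1}^{t_2} f^2(x)\,dx$; - the generalized failure rate functions of $X$ are $h_i(t_1,t_2)=\frac{f(t_i)}{F(t_2)-F(t_1)}$, $i=1,2$. *)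

theory Defs
  imports "HOL-Probability.Probability"
begin

text \<open>Both notions are given by the cdf \<open>F\<close> and the pdf \<open>f\<close> of the random variable. They are
  meaningful only for \<open>0 < t1 < t2\<close> with \<open>F t1 < F t2\<close>; elsewhere their values carry no meaning.\<close>

definition interval_extropy :: "(real \<Rightarrow> real) \<Rightarrow> (real \<Rightarrow> real) \<Rightarrow> real \<Rightarrow> real \<Rightarrow> real" where
  "interval_extropy F f t1 t2 =
     - (1 / (2 * (F t2 - F t1)\<^sup>2)) * (LBINT x:{t1..t2}. (f x)\<^sup>2)"

definition gen_failure_rate1 :: "(real \<Rightarrow> real) \<Rightarrow> (real \<Rightarrow> real) \<Rightarrow> real \<Rightarrow> real \<Rightarrow> real" where
  "gen_failure_rate1 F f t1 t2 = f t1 / (F t2 - F t1)"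

definition gen_failure_rate2 :: "(real \<Rightarrow> real) \<Rightarrow> (real \<Rightarrow> real) \<Rightarrow> real \<Rightarrow> real \<Rightarrow> real" where
  "gen_failure_rate2 F f t1 t2 = f t2 / (F t2 - F t1)"

end

theory Submission
  imports Defs
begin

text \<open>Clearing denominators, the identity reads
  \<open>2 \<integral>\<^sub>s\<^sup>t f\<^sup>2 = (F t - F s) (f s + f t)\<close>. Differentiating in \<open>t\<close> and in \<open>s\<close> gives
  \<open>f t (f t - f s) = (F t - F s) f' t\<close> and \<open>f s (f t - f s) = (F t - F s) f' s\<close>,
  so \<open>f' / f\<close> is a constant \<open>c\<close> and \<open>f x = a exp (c x)\<close>. Since \<open>F\<close> is a cdf with \<open>F 0 = 0\<close>,
  boundedness forces \<open>c < 0\<close> and total mass one forces \<open>a = - c\<close>.\<close>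

text \<open>The indefinite integral from \<open>a\<close> works. The end points \<open>a\<close> and
  \<open>b\<close> are left out so that the derivatives are two-sided, and one \<open>G\<close> can
  be used to vary both limits of an integral.\<close>

lemma continuous_on_antiderivative:
  fixes g :: "real \<Rightarrow> real"
  assumes g: "continuous_on {0<..} g" and a: "0 < a"
  obtains G where "\<And>x. a < x \<Longrightarrow> x < b \<Longrightarrow> (G has_real_derivative g x) (at x)"
    and "\<And>u v. a < u \<Longrightarrow> u \<le> v \<Longrightarrow> v < b \<Longrightarrow> (LBINT x:{u..v}. g x) = G v - G u"
proof -
  define G where "G u = integral {a..u} g" for u
  have cont: "continuous_on {u..v} g" if "0 < u" for u v
    using that by (intro continuous_on_subset[OF g]) auto
  have deriv: "(G has_real_derivative g x) (at x)" if "a < x" "x < b" for x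
    using integral_has_real_derivative[OF cont[OF a, of b], of x] that
    by (simp add: G_def[abs_def] at_within_Icc_at)
  moreover have "(LBINT x:{u..v}. g x) = G v - G u" if "a < u" "u \<le> v" "v < b" for u v
  proof -
    have "(LBINT x:{u..v}. g x) = integral {u..v} g"
      using that a by (intro set_borel_integral_eq_integral borel_integrable_atLeastAtMost' cont) auto
    moreover have "(g has_integral G v - G u) {u..v}"
      using that
      by (intro fundamental_theorem_of_calculus)
        (auto simp: has_real_derivative_iff_has_vector_derivative[symmetric]
          intro!: DERIV_subset[OF deriv])
    ultimately show ?thesis by (simp add: integral_unique)
  qed
  ultimately show thesis using that by blast
qed

text \<open>The increment of the cdf is the mass of a half-open interval, while
  \<open>interval_extropy\<close> integrates over a closed one; the two agree because a point is a
  Lebesgue null set.\<close>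

lemma distributed_cdf_diff:
  assumes "prob_space M" and X: "distributed M lborel X (\<lambda>x. ennreal (f x))"
    and nonneg: "\<And>x. 0 \<le> f x" and cont: "continuous_on {s..t} f" and "s \<le> t"
  shows "cdf (distr M borel X) t - cdf (distr M borel X) s = (LBINT x:{s..t}. f x)"
proof -
  interpret prob_space M by fact
  have Xm [measurable]: "X \<in> borel_measurable M"
    using distributed_measurable[OF X] by simp
  interpret D: prob_space "distr M borel X"
    by (rule prob_space_distr) simp
  interpret D: finite_borel_measure "distr M borel X"
    by unfold_locales auto
  have meas: "(\<lambda>x. ennreal (f x)) \<in> borel_measurable lborel"
    using distributed_borel_measurable[OF X] by simp
  have int: "set_integrable lborel {s..t} f"
    by (rule borel_integrable_atLeastAtMost'[OF cont])
  have "emeasure (distr M borel X) {s<..t} = emeasure (distr M lborel X) {s<..t}"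
    by (simp add: emeasure_distr)
  also have "\<dots> = emeasure (density lborel (\<lambda>x. ennreal (f x))) {s<..t}"
    by (simp add: distributed_distr_eq_density[OF X])
  also have "\<dots> = (\<integral>\<^sup>+x. ennreal (f x) * indicator {s<..t} x \<partial>lborel)"
    using meas by (intro emeasure_density) auto
  \<comment> \<open>The two integrands differ at most at the point \<open>s\<close>.\<close>
  also have "\<dots> = (\<integral>\<^sup>+x. ennreal (indicator {s..t} x *\<^sub>R f x) \<partial>lborel)"
    using AE_lborel_singleton[of s]
    by (intro nn_integral_cong_AE) (auto elim!: eventually_mono simp: indicator_def)
  also have "\<dots> = ennreal (LBINT x:{s..t}. f x)"
    using int unfolding set_integrable_def set_lebesgue_integral_def
    by (intro nn_integral_eq_integral) (auto simp: nonneg)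
  finally have "measure (distr M borel X) {s<..t} = (LBINT x:{s..t}. f x)"
    by (simp add: measure_def set_lebesgue_integral_def Bochner_Integration.integral_nonneg nonneg)
  then show ?thesis
    using \<open>s \<le> t\<close> D.cdf_diff_eq[of s t] by (cases "s = t") (auto simp: set_lebesgue_integral_def
      indicator_def integral_eq_zero_null_sets split: if_splits)
qed

text \<open>An antiderivative is \<open>a / c * exp (c * x)\<close>. The formula for
  \<open>f\<close> is required only from \<open>s\<close> on, since nothing is known about
  \<open>f\<close> on the negative half-line.\<close>

lemma exponential_interval_integral:
  fixes f :: "real \<Rightarrow> real"
  assumes "c \<noteq> 0" "s \<le> t" and f: "\<And>x. s \<le> x \<Longrightarrow> f x = a * exp (c * x)"
  shows "(LBINT x:{s..t}. f x) = a / c * (exp (c * t) - exp (c * s))"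
proof -
  have "(LBINT x:{s..t}. f x) = (LBINT x:{s..t}. a * exp (c * x))"
    by (intro set_lebesgue_integral_cong) (auto simp: f)
  also have "\<dots> = a / c * exp (c * t) - a / c * exp (c * s)"
    unfolding set_lebesgue_integral_def using assms
    by (intro integral_FTC_Icc)
      (auto intro!: derivative_eq_intros continuous_intros
        simp: has_real_derivative_iff_has_vector_derivative[symmetric])
  finally show ?thesis by (simp add: algebra_simps)
qed

theorem theorem4:
  fixes M :: "'a measure" and X :: "'a \<Rightarrow> real" and F f :: "real \<Rightarrow> real"
  assumes "prob_space M"
    and "distributed M lborel X (\<lambda>x. ennreal (f x))"
    and "\<And>x. 0 \<le> f x"
    and "F = cdf (distr M borel X)"
    and "AE \<omega> in M. 0 < X \<omega>"
    and "\<And>x. 0 < x \<Longrightarrow> 0 < f x"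
    and "\<And>x. 0 < x \<Longrightarrow> f differentiable (at x)"
  shows "(\<exists>rate>0. \<forall>x>0. f x = rate * exp (- rate * x)) \<longleftrightarrow>
    (\<forall>t1 t2. 0 < t1 \<and> t1 < t2 \<longrightarrow>
      interval_extropy F f t1 t2 =
        - (1 / 4) * (gen_failure_rate1 F f t1 t2 + gen_failure_rate2 F f t1 t2))"
proof -
  interpret prob_space M by fact
  have Xm [measurable]: "X \<in> borel_measurable M"
    using distributed_measurable[OF assms(2)] by simp
  interpret D: real_distribution "distr M borel X"
    by (simp add: real_distribution_def real_distribution_axioms_def prob_space_distr)

  \<comment> \<open>The cdf as a strictly increasing antiderivative of the density\<close>
  have cont: "continuous_on {0<..} f"
    using assms(7) by (intro differentiable_imp_continuous_on) (auto simp: differentiable_on_def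
        intro: differentiable_at_withinI)
  have Fdiff: "F t - F s = (LBINT x:{s..t}. f x)" if "0 < s" "s \<le> t" for s t
    unfolding assms(4) using that
    by (intro distributed_cdf_diff assms(1-3) continuous_on_subset[OF cont]) auto
  \<comment> \<open>The window from \<open>x/2\<close> to \<open>2*x\<close> is a neighbourhood of
    \<open>x\<close> inside the positive half-line; on it \<open>F\<close> differs from an
    antiderivative of \<open>f\<close> by a constant.\<close>
  have Fderiv: "(F has_real_derivative f x) (at x)" if x: "0 < x" for x
  proof -
    obtain G where G: "\<And>y. x/2 < y \<Longrightarrow> y < 2*x \<Longrightarrow> (G has_real_derivative f y) (at y)"
      "\<And>u v. x/2 < u \<Longrightarrow> u \<le> v \<Longrightarrow> v < 2*x \<Longrightarrow> (LBINT y:{u..v}. f y) = G v - G u"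
      using continuous_on_antiderivative[OF cont, of "x/2" "2*x"] x by auto
    have eq: "F y = F x + (G y - G x)" if "y \<in> {x/2<..<2*x}" for y
      using that x G(2)[of x y] G(2)[of y x] Fdiff[of x y] Fdiff[of y x]
      by (cases "x \<le> y") auto
    have "((\<lambda>y. F x + (G y - G x)) has_real_derivative f x) (at x)"
      using G(1)[of x] x by (auto intro!: derivative_eq_intros)
    then show ?thesis
      by (rule has_field_derivative_transform_within_open[of _ _ _ "{x/2<..<2*x}"])
        (use x in \<open>auto simp del: add_diff_eq intro!: eq[symmetric]\<close>)
  qed
  have Fstrict: "F s < F t" if "0 < s" "s < t" for s t
    using that by (intro DERIV_pos_imp_increasing[of s t F])
      (auto intro!: exI[of _ "f _"] Fderiv assms(6))
  have identity: "interval_extropy F f s t =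
        - (1 / 4) * (gen_failure_rate1 F f s t + gen_failure_rate2 F f s t) \<longleftrightarrow>
      2 * (LBINT x:{s..t}. (f x)\<^sup>2) = (F t - F s) * (f s + f t)" if "0 < s" "s < t" for s t
  proof -
    define d where "d = F t - F s"
    have "d > 0" using Fstrict[OF that] by (simp add: d_def)
    then show ?thesis
      unfolding interval_extropy_def gen_failure_rate1_def gen_failure_rate2_def d_def[symmetric]
      by (simp add: field_simps power2_eq_square)
  qed
  show ?thesis
  proof

    \<comment> \<open>Exponential densities satisfy the identity\<close>
    assume "\<exists>rate>0. \<forall>x>0. f x = rate * exp (- rate * x)"
    then obtain l where l: "l > 0" "\<And>x. x > 0 \<Longrightarrow> f x = l * exp (- l * x)" by auto
    have "2 * (LBINT x:{s..t}. (f x)\<^sup>2) = (F t - F s) * (f s + f t)" if st: "0 < s" "s < t" for s t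
    proof -
      \<comment> \<open>The square of \<open>f\<close> is again exponential, with exponent
        \<open>- 2 * l\<close>. Written with squares, the claim becomes the factorisation of a
        difference of two squares.\<close>
      have sq: "exp (- 2 * l * x) = (exp (- l * x))\<^sup>2" for x
        by (simp add: power2_eq_square flip: exp_add)
      have int_sq: "(LBINT x:{s..t}. (f x)\<^sup>2) =
          l\<^sup>2 / (- 2 * l) * (exp (- 2 * l * t) - exp (- 2 * l * s))"
      proof (rule exponential_interval_integral)
        show "(f x)\<^sup>2 = l\<^sup>2 * exp (- 2 * l * x)" if "s \<le> x" for x
          unfolding sq using that st l(2)[of x] by (simp only: power_mult_distrib)
      qed (use st l in auto)
      have "F t - F s = (LBINT x:{s..t}. f x)"
        using st by (intro Fdiff) auto
      also have "\<dots> = l / (- l) * (exp (- l * t) - exp (- l * s))"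
        using st l by (intro exponential_interval_integral) auto
      finally have F: "F t - F s = exp (- l * s) - exp (- l * t)"
        using l(1) by simp
      have ff: "f s + f t = l * (exp (- l * s) + exp (- l * t))"
        using l(2)[of s] l(2)[of t] st by (simp add: algebra_simps)
      show ?thesis
        unfolding int_sq F ff sq using l(1)
        by (simp add: field_simps power2_eq_square)
    qed
    then show "\<forall>t1 t2. 0 < t1 \<and> t1 < t2 \<longrightarrow> interval_extropy F f t1 t2 =
        - (1 / 4) * (gen_failure_rate1 F f t1 t2 + gen_failure_rate2 F f t1 t2)"
      using identity by blast
  next

    \<comment> \<open>From the identity to a constant logarithmic derivative\<close>
    assume "\<forall>t1 t2. 0 < t1 \<and> t1 < t2 \<longrightarrow> interval_extropy F f t1 t2 =
        - (1 / 4) * (gen_failure_rate1 F f t1 t2 + gen_failure_rate2 F f t1 t2)"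
    then have H: "2 * (LBINT x:{s..t}. (f x)\<^sup>2) = (F t - F s) * (f s + f t)"
      if "0 < s" "s < t" for s t
      using identity that by blast
    have fderiv: "(f has_real_derivative deriv f x) (at x)" if "0 < x" for x
      using assms(7)[OF that] by (simp add: DERIV_deriv_iff_real_differentiable)
    have ratio: "deriv f s / f s = deriv f t / f t" if st: "0 < s" "s < t" for s t
    proof -
      \<comment> \<open>The window from \<open>s/2\<close> to \<open>2*t\<close> has both
        \<open>s\<close> and \<open>t\<close> in its interior, so the same \<open>Q\<close> can be
        differentiated at either end.\<close>
      obtain Q where Q:
        "\<And>y. s/2 < y \<Longrightarrow> y < 2*t \<Longrightarrow> (Q has_real_derivative (f y)\<^sup>2) (at y)"
        "\<And>u v. s/2 < u \<Longrightarrow> u \<le> v \<Longrightarrow> v < 2*t \<Longrightarrow> (LBINT y:{u..v}. (f y)\<^sup>2) = Q v - Q u"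
        using continuous_on_antiderivative[of "\<lambda>x. (f x)\<^sup>2" "s/2" "2*t"] st
          continuous_on_power[OF cont] by auto
      have HQ: "2 * (Q v - Q u) = (F v - F u) * (f u + f v)" if "s/2 < u" "u < v" "v < 2*t" for u v
        using H[of u v] Q(2)[of u v] that st by auto
      \<comment> \<open>The upper end point varies near \<open>t\<close>: both sides of
        \<open>HQ\<close> are differentiated and the two derivatives compared.\<close>
      have "((\<lambda>v. 2 * (Q v - Q s)) has_real_derivative 2 * (f t)\<^sup>2) (at t)"
        using st by (auto intro!: derivative_eq_intros Q(1))
      then have "((\<lambda>v. (F v - F s) * (f s + f v)) has_real_derivative 2 * (f t)\<^sup>2) (at t)"
        by (rule has_field_derivative_transform_within_open[of _ _ _ "{s<..<2*t}"])
          (use st HQ in auto)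
      moreover have "((\<lambda>v. (F v - F s) * (f s + f v)) has_real_derivative
          f t * (f s + f t) + (F t - F s) * deriv f t) (at t)"
        using st by (auto intro!: derivative_eq_intros Fderiv fderiv)
      ultimately have "2 * (f t)\<^sup>2 = f t * (f s + f t) + (F t - F s) * deriv f t"
        by (rule DERIV_unique)
      then have t: "(F t - F s) * deriv f t = f t * (f t - f s)"
        by (simp add: algebra_simps power2_eq_square)
      \<comment> \<open>The same comparison with the lower end point varying near
        \<open>s\<close>.\<close>
      have "((\<lambda>u. 2 * (Q t - Q u)) has_real_derivative - 2 * (f s)\<^sup>2) (at s)"
        using st by (auto intro!: derivative_eq_intros Q(1))
      then have "((\<lambda>u. (F t - F u) * (f u + f t)) has_real_derivative - 2 * (f s)\<^sup>2) (at s)"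
        by (rule has_field_derivative_transform_within_open[of _ _ _ "{s/2<..<t}"])
          (use st HQ in auto)
      moreover have "((\<lambda>u. (F t - F u) * (f u + f t)) has_real_derivative
          - f s * (f s + f t) + (F t - F s) * deriv f s) (at s)"
        using st by (auto intro!: derivative_eq_intros Fderiv fderiv)
      ultimately have "- 2 * (f s)\<^sup>2 = - f s * (f s + f t) + (F t - F s) * deriv f s"
        by (rule DERIV_unique)
      then have s: "(F t - F s) * deriv f s = f s * (f t - f s)"
        by (simp add: algebra_simps power2_eq_square)
      have pos: "F t - F s \<noteq> 0" "f s \<noteq> 0" "f t \<noteq> 0"
        using Fstrict[OF st] assms(6)[of s] assms(6)[of t] st by auto
      have "(F t - F s) * (deriv f s / f s) = f t - f s"
        using s pos by (simp add: field_simps)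
      moreover have "(F t - F s) * (deriv f t / f t) = f t - f s"
        using t pos by (simp add: field_simps)
      ultimately have "(F t - F s) * (deriv f s / f s) = (F t - F s) * (deriv f t / f t)"
        by simp
      then show ?thesis using pos(1) mult_cancel_left by blast
    qed
    define c where "c = deriv f 1 / f 1"
    have fc: "(f has_real_derivative c * f x) (at x)" if "0 < x" for x
    proof -
      have "deriv f x / f x = c"
        using ratio[of 1 x] ratio[of x 1] that by (cases x "1::real" rule: linorder_cases) (auto simp: c_def)
      then show ?thesis
        using fderiv[OF that] assms(6)[OF that] by (auto simp: field_simps)
    qed
    \<comment> \<open>The derivative of this product vanishes by \<open>fc\<close>, and the
      half-line is convex.\<close>
    have "\<exists>a. \<forall>x\<in>{0<..}. f x * exp (- c * x) = a"
      by (rule has_field_derivative_zero_constant)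
        (auto intro!: derivative_eq_intros DERIV_subset[OF fc])
    then obtain a where a: "\<And>x. x \<in> {0<..} \<Longrightarrow> f x * exp (- c * x) = a"
      by blast
    have f: "f x = a * exp (c * x)" if "0 < x" for x
      using a[of x] that by (auto simp: exp_minus field_simps)
    have "a > 0"
      using a[of 1] assms(6)[of 1] by (metis exp_gt_zero greaterThan_iff mult_pos_pos zero_less_one)

    \<comment> \<open>Sign of the exponent and normalisation\<close>
    have lim: "(F \<longlongrightarrow> 1) at_top"
      unfolding assms(4) by (rule D.cdf_lim_at_top_prob)
    \<comment> \<open>Almost sure positivity of \<open>X\<close> leaves no mass on the closed
      negative half-line.\<close>
    have F0: "F 0 = 0"
    proof -
      have "F 0 = prob (X -` {..0} \<inter> space M)"
        by (simp add: assms(4) cdf_def measure_distr)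
      also have "\<dots> = 0"
        using assms(5) by (subst prob_eq_0) (auto elim!: eventually_mono)
      finally show ?thesis .
    qed
    have lim0: "(F \<longlongrightarrow> 0) (at_right 0)"
      using D.cdf_is_right_cont[of 0] F0 by (simp add: assms(4) continuous_within)
    have "c < 0"
    proof (rule ccontr)
      assume "\<not> c < 0"
      then have ge: "a \<le> f x" if "0 < x" for x
        using that \<open>a > 0\<close> by (simp add: f)
      \<comment> \<open>The length \<open>1 / a\<close> is chosen so that a density of at least
        \<open>a\<close> gains mass at least one after the point 1. This leaves \<open>F 1\<close>
        at most 0, against \<open>F (1/2) < F 1\<close>.\<close>
      have "F 1 + a * (1 / a) \<le> F (1 + 1 / a)"
      proof -
        obtain z where "1 < z" "F (1 + 1/a) - F 1 = (1 + 1/a - 1) * f z"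
          using MVT2[of 1 "1 + 1/a" F f] Fderiv \<open>a > 0\<close> by auto
        moreover have "1 / a * a \<le> 1 / a * f z"
          using ge[of z] \<open>1 < z\<close> \<open>a > 0\<close> by (intro mult_left_mono) auto
        ultimately show ?thesis by simp
      qed
      moreover have "F (1 + 1/a) \<le> 1" "F (1/2) \<ge> 0"
        by (auto simp: assms(4) D.cdf_bounded_prob D.cdf_nonneg)
      ultimately show False using Fstrict[of "1/2" 1] \<open>a > 0\<close> by auto
    qed
    have Fexp: "F t - F s = a / c * (exp (c * t) - exp (c * s))" if "0 < s" "s \<le> t" for s t
      unfolding Fdiff[OF that] using that \<open>c < 0\<close>
      by (intro exponential_interval_integral f) auto
    \<comment> \<open>Let \<open>t\<close> tend to infinity in \<open>Fexp\<close>; the term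
      \<open>exp (c * t)\<close> vanishes since \<open>c\<close> is negative.\<close>
    have tail: "1 - F s = - (a / c) * exp (c * s)" if "0 < s" for s
    proof (rule tendsto_unique[of at_top])
      show "((\<lambda>t. F t - F s) \<longlongrightarrow> 1 - F s) at_top"
        by (intro tendsto_intros lim)
      have "((\<lambda>t. exp (c * t)) \<longlongrightarrow> 0) at_top"
        using \<open>c < 0\<close> by (intro filterlim_compose[OF exp_at_bot]
            filterlim_tendsto_neg_mult_at_bot[OF tendsto_const] filterlim_ident)
      then have "((\<lambda>t. a / c * (exp (c * t) - exp (c * s))) \<longlongrightarrow> a / c * (0 - exp (c * s))) at_top"
        by (intro tendsto_intros)
      moreover have "eventually (\<lambda>t. a / c * (exp (c * t) - exp (c * s)) = F t - F s) at_top"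
        using eventually_ge_at_top[of s] by eventually_elim (simp add: Fexp that)
      ultimately show "((\<lambda>t. F t - F s) \<longlongrightarrow> - (a / c) * exp (c * s)) at_top"
        using Lim_transform_eventually by fastforce
    qed simp
    \<comment> \<open>Both sides are limits of \<open>1 - F s\<close> as \<open>s\<close> decreases
      to 0: the left by right-continuity of the cdf, the right by \<open>tail\<close>, which holds
      only for positive \<open>s\<close>.\<close>
    have "1 - 0 = - (a / c) * exp (c * 0)"
    proof (rule tendsto_unique[of "at_right 0"])
      show "((\<lambda>s. 1 - F s) \<longlongrightarrow> 1 - 0) (at_right 0)"
        by (intro tendsto_intros lim0)
      have "((\<lambda>s. - (a / c) * exp (c * s)) \<longlongrightarrow> - (a / c) * exp (c * 0)) (at_right 0)"
        by (intro tendsto_intros)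
      moreover have "eventually (\<lambda>s. - (a / c) * exp (c * s) = 1 - F s) (at_right 0)"
        using eventually_at_right_less[of "0::real"] by eventually_elim (simp add: tail)
      ultimately show "((\<lambda>s. 1 - F s) \<longlongrightarrow> - (a / c) * exp (c * 0)) (at_right 0)"
        by (rule Lim_transform_eventually)
    qed simp
    then have "a = - c" using \<open>c < 0\<close> by (simp add: field_simps)
    then show "\<exists>rate>0. \<forall>x>0. f x = rate * exp (- rate * x)"
      using \<open>c < 0\<close> f by (intro exI[of _ "- c"]) auto
  qed
qed

end
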